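(* Let $m,n$ be positive integers with $\min\{m,n\}<3$, and let $A\in\mathbb C^{m\times m}$, $B\in\mathbb C^{n\times n}$, $C\in\mathbb C^{m\times n}$. Then \[ \min_{X\in \mathbb C^{m\times n}}\operatorname{rank}(AX-XB-C)=\min_{P\in \mathrm{GL}(m+n,\mathbb C)}\operatorname{rank}\left(P\begin{pmatrix}A&C\\0&B\end{pmatrix}-\begin{pmatrix}A&0\\0&B\end{pmatrix}P\right). \]
   Context: $\mathrm{GL}(r,\mathbb C)$ denotes the set of invertible matrices in $\mathbb C^{r\times r}$. The block matrices have size $(m+n)\times(m+n)$. *)

theory Defs
  imports "Jordan_Normal_Form.DL_Rank"
begin

definition GL :: "nat \<Rightarrow> complex mat set" where
  "GL r = {P \<in> carrier_mat r r. invertible_mat P}"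

(* The dimension argument of vec_space.rank is the number of rows. *)
abbreviation rank_rows :: "nat \<Rightarrow> complex mat \<Rightarrow> nat" where
  "rank_rows r M \<equiv> vec_space.rank r M"

(* The minima in the statement are attained: both sets of ranks are nonempty and bounded. *)
lemma finite_rank_image:
  assumes "\<And>x. x \<in> S \<Longrightarrow> f x \<in> carrier_mat r c"
  shows "finite ((\<lambda>x. rank_rows r (f x)) ` S)"
proof (rule finite_subset)
  show "(\<lambda>x. rank_rows r (f x)) ` S \<subseteq> {..c}"
  proof (rule image_subsetI)
    fix x assume "x \<in> S"
    show "rank_rows r (f x) \<in> {..c}"
      unfolding atMost_iff by (rule vec_space.rank_le_nc[OF assms[OF \<open>x \<in> S\<close>]])
  qed
qed simp

lemma one_mat_in_GL: "1\<^sub>m r \<in> GL r"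
proof -
  have "1\<^sub>m r * 1\<^sub>m r = (1\<^sub>m r :: complex mat)"
    by (rule left_mult_one_mat[OF one_carrier_mat])
  then have "inverts_mat (1\<^sub>m r) (1\<^sub>m r :: complex mat)"
    unfolding inverts_mat_def index_one_mat .
  then have "\<exists>Q :: complex mat. inverts_mat (1\<^sub>m r) Q \<and> inverts_mat Q (1\<^sub>m r)"
    by (intro exI conjI)
  then have "invertible_mat (1\<^sub>m r :: complex mat)"
    unfolding invertible_mat_def by (intro conjI) simp_all
  then show ?thesis
    unfolding GL_def by simp
qed

end

(* Conjugating by P = [[1, X], [0, 1]] bounds the right-hand minimum by the left-hand one.
   Conversely let k = rank (P M - N P), with M and N the two block matrices; transposing and
   exchanging the blocks reduces to n <= 2.
   If B = b 1, then rank (M - b 1) <= rank (N - b 1) + k, which compares rank [A - b 1, C] with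
   rank (A - b 1), and reducing C modulo the columns of A - b 1 gives X.
   Otherwise n = 2 and B has a cyclic vector e, so X may be prescribed by the values X e and X B e.
   If k >= 1, the choice X e = 0, X B e = - C e makes A X - X B - C kill e, so it has rank <= 1.
   If k = 0, let q be the characteristic polynomial of B.  Then q(M) and q(N) have equal rank, and
   only their first block row is nonzero: [q(A), S] and [q(A), 0].  Hence q(A) Z = S is solvable,
   and X e = Z e, X B e = A Z e - C e is an exact solution of A X - X B = C. *)

theory Submission
  imports Defs
begin

section \<open>Column bases, rank factorization and column reduction\<close>

lemma sum_lessThan_add_if:
  fixes f g :: "nat \<Rightarrow> 'a::comm_monoid_add"
  shows "(\<Sum>l<k + c. if l < k then f l else g (l - k)) = (\<Sum>l<k. f l) + (\<Sum>l<c. g l)"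
  by (induction c) (simp_all add: add.assoc)

context vec_space
begin

text \<open>A vector of \<open>S\<close> outside \<open>span U\<close> could be adjoined to
  \<open>U\<close> without losing independence, against maximality.\<close>

lemma maximal_lin_indpt_span:
  assumes "S \<subseteq> carrier_vec n" and "maximal U (\<lambda>T. T \<subseteq> S \<and> lin_indpt T)"
  shows "S \<subseteq> span U"
proof
  fix s assume s: "s \<in> S"
  have U: "U \<subseteq> S" "lin_indpt U" "U \<subseteq> carrier_vec n"
    using assms unfolding maximal_def by auto
  have "s \<in> U" if "lin_indpt (U \<union> {s})"
    using assms(2) U s that unfolding maximal_def by (metis Un_upper1 insert_subset Un_insert_right le_sup_iff sup_bot_right)
  then show "s \<in> span U"
    using lin_dep_iff_in_span[of U s] U s assms(1) span_mem[of U s] by auto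
qed

lemma column_basis:
  assumes "M \<in> carrier_mat n c"
  obtains U where "finite U" "U \<subseteq> set (cols M)" "lin_indpt U" "card U = rank M" "set (cols M) \<subseteq> span U"
proof -
  have M: "set (cols M) \<subseteq> carrier_vec n" using cols_dim assms by blast
  have "lin_indpt {}" by (simp add: finite_lin_indpt2)
  then obtain U where U: "maximal U (\<lambda>T. T \<subseteq> set (cols M) \<and> lin_indpt T)" "finite U"
    using maximal_exists_superset[of "set (cols M)" "\<lambda>T. T \<subseteq> set (cols M) \<and> lin_indpt T" "{}"] by blast
  show thesis
    using that[OF U(2)] rank_card_indpt[OF assms U(1)] maximal_lin_indpt_span[OF M U(1)] U(1)
    unfolding maximal_def by auto
qed

text \<open>Steinitz exchange: a column basis of \<open>M\<close> is an independent set inside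
  \<open>span K\<close>, hence not larger than \<open>K\<close>.\<close>

lemma rank_le_card_span:
  assumes "M \<in> carrier_mat n c" and "finite K" and "K \<subseteq> carrier_vec n" and "set (cols M) \<subseteq> span K"
  shows "rank M \<le> card K"
proof -
  obtain U where U: "finite U" "U \<subseteq> set (cols M)" "lin_indpt U" "card U = rank M"
    using column_basis[OF assms(1)] by metis
  have "U \<subseteq> span K" using U assms by auto
  from replacement[OF U(1) assms(2) _ U(3) this] assms(3) U(4) show ?thesis by auto
qed

text \<open>Each column of \<open>M\<close> has the form \<open>U *\<^sub>v x\<close>; these
  coefficient vectors are the columns of \<open>X\<close>.\<close>

lemma span_cols_matE:
  assumes "U \<in> carrier_mat n k" and "M \<in> carrier_mat n c" and "set (cols M) \<subseteq> span (set (cols U))"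
  obtains X where "X \<in> carrier_mat k c" "M = U * X"
proof -
  have "\<exists>x\<in>carrier_vec k. U *\<^sub>v x = col M j" if "j < c" for j
  proof -
    have "col M j \<in> set (cols M)" using that assms(2) by (metis carrier_matD(2) cols_length cols_nth nth_mem)
    then have "col M j \<in> col_space U" using assms(3) unfolding col_space_def by auto
    then show ?thesis unfolding col_space_eq[OF assms(1)] using assms(1) by auto
  qed
  then obtain x where x: "\<And>j. j < c \<Longrightarrow> x j \<in> carrier_vec k \<and> U *\<^sub>v x j = col M j" by metis
  let ?X = "mat_of_cols k (map x [0..<c])"
  have "M = U * ?X"
  proof (rule mat_col_eqI)
    fix j assume "j < dim_col (U * ?X)"
    then have j: "j < c" by simp
    have X: "?X \<in> carrier_mat k c" using mat_of_cols_carrier(1)[of k "map x [0..<c]"] by simp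
    show "col M j = col (U * ?X) j"
      unfolding col_mult2[OF assms(1) X j] using x[OF j] j by simp
  qed (use assms in auto)
  then show thesis using that[of ?X] mat_of_cols_carrier(1)[of k "map x [0..<c]"] by simp
qed

text \<open>The columns of \<open>U\<close> are a column basis of \<open>M\<close>, and
  \<open>W\<close> holds the coordinates. Together with the bound on products below, this describes
  rank as the smallest inner dimension of a factorization, which drives the later rank
  inequalities.\<close>

lemma rank_factorization:
  assumes "M \<in> carrier_mat n c"
  obtains U W where "U \<in> carrier_mat n (rank M)" "W \<in> carrier_mat (rank M) c" "M = U * W"
proof -
  obtain K where K: "finite K" "K \<subseteq> set (cols M)" "card K = rank M" "set (cols M) \<subseteq> span K"
    using column_basis[OF assms] by metis
  obtain us where us: "set us = K" "length us = rank M" using K(1,3) by (metis finite_distinct_list distinct_card)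
  have usc: "set us \<subseteq> carrier_vec n" using us K(2) cols_dim assms by blast
  have "mat_of_cols n us \<in> carrier_mat n (rank M)" using us by (metis mat_of_cols_carrier(1))
  moreover have "set (cols M) \<subseteq> span (set (cols (mat_of_cols n us)))" using us usc K by simp
  ultimately show thesis using that span_cols_matE[OF _ assms] by metis
qed

text \<open>The columns of a product lie in the column space of the left factor, which
  \<open>k\<close> columns span.\<close>

lemma rank_mult_le_inner:
  assumes "U \<in> carrier_mat n k" and "W \<in> carrier_mat k c"
  shows "rank (U * W) \<le> k"
proof -
  have UW: "U * W \<in> carrier_mat n c" using assms by simp
  have "set (cols (U * W)) \<subseteq> col_space U"
  proof
    fix v assume "v \<in> set (cols (U * W))"
    then obtain j where j: "j < c" "v = col (U * W) j"
      using UW by (metis carrier_matD(2) cols_length cols_nth in_set_conv_nth)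
    then have "v = U *\<^sub>v col W j" using col_mult2[OF assms j(1)] by simp
    moreover have "col W j \<in> carrier_vec k" using j assms by auto
    ultimately show "v \<in> col_space U" unfolding col_space_eq[OF assms(1)] using assms by auto
  qed
  then have "rank (U * W) \<le> card (set (cols U))"
    using rank_le_card_span[OF UW, of "set (cols U)"] cols_dim[of U] assms(1)
    unfolding col_space_def by simp
  also have "\<dots> \<le> k" using assms(1) card_length[of "cols U"] by simp
  finally show ?thesis .
qed

text \<open>A factorization through inner dimension 0 has only empty sums as entries.\<close>

lemma rank_zeroD:
  assumes "M \<in> carrier_mat n c" and "rank M = 0"
  shows "M = 0\<^sub>m n c"
proof -
  obtain U W where UW: "U \<in> carrier_mat n 0" "W \<in> carrier_mat 0 c" and M: "M = U * W"
    using rank_factorization[OF assms(1)] unfolding assms(2) by blast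
  show ?thesis unfolding M by (rule eq_matI) (use UW in \<open>auto simp: scalar_prod_def\<close>)
qed

text \<open>The columns of \<open>S\<close> reduce modulo the column space of \<open>D\<close> to combinations of the vectors
  that extend a basis of that space to a basis of the column space of \<open>E\<close>.\<close>

lemma rank_reduce_columns:
  assumes D: "D \<in> carrier_mat n k" and S: "S \<in> carrier_mat n c" and E: "E \<in> carrier_mat n l"
    and DE: "set (cols D) \<subseteq> set (cols E)" and SE: "set (cols S) \<subseteq> set (cols E)"
  obtains X where "X \<in> carrier_mat k c" "rank D + rank (D * X - S) \<le> rank E"
proof -
  obtain BD where BD: "finite BD" "BD \<subseteq> set (cols D)" "lin_indpt BD" "card BD = rank D"
    using column_basis[OF D] by metis
  obtain BE where BE: "finite BE" "BE \<subseteq> set (cols E)" "card BE = rank E" "set (cols E) \<subseteq> span BE"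
    using column_basis[OF E] by metis
  have carr: "set (cols D) \<subseteq> carrier_vec n" "set (cols E) \<subseteq> carrier_vec n"
    using D E cols_dim by blast+
  have "BD \<subseteq> span BE" using BD(2) DE BE(4) by blast
  \<comment> \<open>Steinitz exchange completes \<open>BD\<close> by a set \<open>C\<close> of at
    most \<open>rank E - rank D\<close> vectors to a spanning set of \<open>span BE\<close>.\<close>
  then obtain C where C: "finite C" "C \<subseteq> carrier_vec n" "int (card C) \<le> int (card BE) - int (card BD)"
      "span (BD \<union> C) = span BE"
    using replacement[OF BD(1) BE(1) _ BD(3)] BE(2) carr by (metis cV subset_trans)
  obtain cs where cs: "set cs = C" "length cs = card C" using C(1) by (metis finite_distinct_list distinct_card)
  let ?C = "mat_of_cols n cs"
  have Cm: "?C \<in> carrier_mat n (card C)" using cs by (metis mat_of_cols_carrier(1))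
  \<comment> \<open>All columns of \<open>D\<close> are listed, not only the basis
    \<open>BD\<close>, so that the first \<open>k\<close> coefficient rows act on \<open>D\<close>
    itself.\<close>
  let ?W = "mat_of_cols n (cols D @ cs)"
  have Wm: "?W \<in> carrier_mat n (k + card C)"
    using mat_of_cols_carrier(1)[of n "cols D @ cs"] D cs by simp
  have colW: "set (cols ?W) = set (cols D) \<union> C" using cs C(2) carr by simp
  have "span BE \<subseteq> span (set (cols D) \<union> C)" 
    unfolding C(4)[symmetric] using BD(2) by (intro span_is_monotone) blast
  then have "set (cols S) \<subseteq> span (set (cols ?W))" using SE BE(4) colW by auto
  then obtain Z where Z: "Z \<in> carrier_mat (k + card C) c" "S = ?W * Z"
    using span_cols_matE[OF Wm S] by metis
  \<comment> \<open>Splitting the rows of \<open>Z\<close> at \<open>k\<close> writes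
    \<open>S\<close> as \<open>D * X - ?C * Y\<close>, so that \<open>D * X - S\<close> factors
    through \<open>card C\<close> columns.\<close>
  define X where "X = mat k c (\<lambda>(i,j). Z $$ (i,j))"
  define Y where "Y = mat (card C) c (\<lambda>(i,j). - Z $$ (i + k,j))"
  have "D * X - S = ?C * Y"
  proof (rule eq_matI)
    fix i j assume "i < dim_row (?C * Y)" "j < dim_col (?C * Y)"
    then have ij: "i < n" "j < c" by (auto simp: Y_def)
    have W: "?W $$ (i,l) = (if l < k then D $$ (i,l) else ?C $$ (i,l-k))" if "l < k + card C" for l
      using that ij D cs by (auto simp: mat_of_cols_index nth_append)
    have "S $$ (i,j) = (\<Sum>l<k + card C. ?W $$ (i,l) * Z $$ (l,j))"
      unfolding Z(2) using ij Z(1) Wm D cs by (auto simp: scalar_prod_def lessThan_atLeast0)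
    also have "\<dots> = (\<Sum>l<k + card C. if l < k then D $$ (i,l) * Z $$ (l,j) else ?C $$ (i,l-k) * Z $$ (l-k+k,j))"
      using W by (intro sum.cong) auto
    also have "\<dots> = (\<Sum>l<k. D $$ (i,l) * Z $$ (l,j)) + (\<Sum>l<card C. ?C $$ (i,l) * Z $$ (l + k,j))"
      by (rule sum_lessThan_add_if)
    finally show "(D * X - S) $$ (i,j) = (?C * Y) $$ (i,j)"
      using ij D S cs by (auto simp: X_def Y_def scalar_prod_def lessThan_atLeast0 sum_negf)
  qed (use S cs in \<open>auto simp: Y_def\<close>)
  then have "rank (D * X - S) \<le> card C"
    using rank_mult_le_inner[OF Cm, of Y c] by (simp add: Y_def)
  then show thesis using that[of X] C(3) BD(4) BE(3) by (auto simp: X_def)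
qed

end

section \<open>Rank under products and transposition\<close>

text \<open>Multiplying or transposing a factorization \<open>M = U * V\<close> keeps its inner
  dimension; the next two lemmas rest on the same argument.\<close>

lemma rank_mult_left_le:
  assumes "P \<in> carrier_mat r n" and "M \<in> carrier_mat n c"
  shows "vec_space.rank r (P * M) \<le> vec_space.rank n (M :: 'a::field mat)"
proof -
  obtain U V where UV: "U \<in> carrier_mat n (vec_space.rank n M)" "V \<in> carrier_mat (vec_space.rank n M) c" "M = U * V"
    using vec_space.rank_factorization[OF assms(2)] .
  then have "P * M = (P * U) * V" using assoc_mult_mat[OF assms(1) UV(1,2)] by simp
  then show ?thesis using vec_space.rank_mult_le_inner[OF mult_carrier_mat[OF assms(1) UV(1)] UV(2)] by simp
qed

lemma rank_mult_right_le:
  assumes "M \<in> carrier_mat n c" and "Q \<in> carrier_mat c d"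
  shows "vec_space.rank n (M * Q) \<le> vec_space.rank n (M :: 'a::field mat)"
proof -
  obtain U V where UV: "U \<in> carrier_mat n (vec_space.rank n M)" "V \<in> carrier_mat (vec_space.rank n M) c" "M = U * V"
    using vec_space.rank_factorization[OF assms(1)] .
  then have "M * Q = U * (V * Q)" using assoc_mult_mat[OF UV(1,2) assms(2)] by simp
  then show ?thesis using vec_space.rank_mult_le_inner[OF UV(1) mult_carrier_mat[OF UV(2) assms(2)]] by simp
qed

lemma rank_transpose_le:
  assumes "M \<in> carrier_mat n c"
  shows "vec_space.rank c (M\<^sup>T) \<le> vec_space.rank n (M :: 'a::field mat)"
proof -
  obtain U V where UV: "U \<in> carrier_mat n (vec_space.rank n M)" "V \<in> carrier_mat (vec_space.rank n M) c" "M = U * V"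
    using vec_space.rank_factorization[OF assms] .
  then have "M\<^sup>T = V\<^sup>T * U\<^sup>T" using transpose_mult by blast
  then show ?thesis using vec_space.rank_mult_le_inner[of "V\<^sup>T" c _ "U\<^sup>T" n] UV(1,2) by simp
qed

section \<open>From a rank comparison of block matrices to a reduction of the corner block\<close>

lemma minus_four_block_mat:
  fixes A1 :: "'a::ring mat"
  assumes "A1 \<in> carrier_mat nr1 nc1" "B1 \<in> carrier_mat nr1 nc2" "C1 \<in> carrier_mat nr2 nc1" "D1 \<in> carrier_mat nr2 nc2"
    and "A2 \<in> carrier_mat nr1 nc1" "B2 \<in> carrier_mat nr1 nc2" "C2 \<in> carrier_mat nr2 nc1" "D2 \<in> carrier_mat nr2 nc2"
  shows "four_block_mat A1 B1 C1 D1 - four_block_mat A2 B2 C2 D2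
    = four_block_mat (A1 - A2) (B1 - B2) (C1 - C2) (D1 - D2)"
  by (rule eq_matI) (use assms in auto)

text \<open>Removing the zero rows and columns turns the hypothesis into rank [D, S] \<le> rank D +
  \<open>k\<close>. Column reduction of \<open>S\<close> modulo \<open>D\<close> inside [D, S] then
  costs at most \<open>k\<close>.\<close>

lemma rank_block_reduce:
  fixes D S :: "'a::field mat"
  assumes D: "D \<in> carrier_mat m m" and S: "S \<in> carrier_mat m n"
    and rank: "vec_space.rank (m + n) (four_block_mat D S (0\<^sub>m n m) (0\<^sub>m n n))
      \<le> vec_space.rank (m + n) (four_block_mat D (0\<^sub>m m n) (0\<^sub>m n m) (0\<^sub>m n n)) + k"
  obtains X where "X \<in> carrier_mat m n" "vec_space.rank m (D * X - S) \<le> k"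
proof -
  let ?E = "four_block_mat D S (0\<^sub>m 0 m) (0\<^sub>m 0 n)"
  let ?F = "four_block_mat D S (0\<^sub>m n m) (0\<^sub>m n n)"
  \<comment> \<open>\<open>?L\<close> projects onto the first \<open>m\<close> coordinates and
    \<open>?R\<close> embeds them. \<open>?D\<close> is \<open>D\<close> with empty blocks attached,
    a form to which block multiplication applies.\<close>
  let ?L = "four_block_mat (1\<^sub>m m) (0\<^sub>m m n) (0\<^sub>m 0 m) (0\<^sub>m 0 n)"
  let ?R = "four_block_mat (1\<^sub>m m) (0\<^sub>m m 0) (0\<^sub>m n m) (0\<^sub>m n 0)"
  let ?D = "four_block_mat D (0\<^sub>m m 0) (0\<^sub>m 0 m) (0\<^sub>m 0 0)"
  have Em: "?E \<in> carrier_mat m (m + n)" by (rule carrier_matI) (use D in auto)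
  have Fm: "?F \<in> carrier_mat (m + n) (m + n)" using D by simp
  have Lm: "?L \<in> carrier_mat m (m + n)" by (rule carrier_matI) auto
  have Rm: "?R \<in> carrier_mat (m + n) m" by (rule carrier_matI) auto
  have "?E = ?L * ?F"
    by (subst mult_four_block_mat[of _ m m _ n _ 0 _ _ m _ n]) (use D S in auto)
  then have E: "vec_space.rank m ?E \<le> vec_space.rank (m + n) ?F"
    using rank_mult_left_le[OF Lm Fm] by simp
  have D': "?D = D" by (rule eq_matI) (use D in auto)
  have "?R * ?D = four_block_mat D (0\<^sub>m m 0) (0\<^sub>m n m) (0\<^sub>m n 0)"
    by (subst mult_four_block_mat[of _ m m _ 0 _ n _ _ m _ 0]) (use D in auto)
  then have "?R * D * ?L = four_block_mat D (0\<^sub>m m n) (0\<^sub>m n m) (0\<^sub>m n n)"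
    unfolding D' by (simp, subst mult_four_block_mat[of _ m m _ 0 _ n _ _ m _ n]) (use D in auto)
  then have "vec_space.rank (m + n) (four_block_mat D (0\<^sub>m m n) (0\<^sub>m n m) (0\<^sub>m n n)) \<le> vec_space.rank m D"
    using rank_mult_right_le[OF mult_carrier_mat[OF Rm D] Lm] rank_mult_left_le[OF Rm D] by simp
  moreover have "set (cols D) \<subseteq> set (cols ?E)" "set (cols S) \<subseteq> set (cols ?E)"
  proof -
    have colE: "col ?E j \<in> set (cols ?E)" if "j < m + n" for j
      using that Em by (metis carrier_matD(2) cols_length cols_nth nth_mem)
    have "col D j = col ?E j" if "j < m" for j
      by (rule eq_vecI) (use that D S in auto)
    moreover have "col S j = col ?E (m + j)" if "j < n" for j
      by (rule eq_vecI) (use that D S in auto)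
    ultimately show "set (cols D) \<subseteq> set (cols ?E)" "set (cols S) \<subseteq> set (cols ?E)"
      using colE D S by (auto simp: cols_def)
  qed
  then obtain X where "X \<in> carrier_mat m n" "vec_space.rank m D + vec_space.rank m (D * X - S) \<le> vec_space.rank m ?E"
    using vec_space.rank_reduce_columns[OF D S Em] by metis
  ultimately show thesis using that[of X] E rank by linarith
qed

section \<open>Approximate and exact intertwining of two matrices\<close>

text \<open>Since \<open>M = Q * (P * M)\<close>, the rank of \<open>M\<close> is at most that of
  \<open>P * M\<close>, which is \<open>N * P\<close> plus the intertwining defect.\<close>

lemma rank_le_intertwining:
  fixes P Q M N :: "'a::field mat"
  assumes P: "P \<in> carrier_mat r r" and Q: "Q \<in> carrier_mat r r" and M: "M \<in> carrier_mat r r" and N: "N \<in> carrier_mat r r"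
    and QP: "Q * P = 1\<^sub>m r"
  shows "vec_space.rank r M \<le> vec_space.rank r N + vec_space.rank r (P * M - N * P)"
proof -
  have PM: "P * M \<in> carrier_mat r r" and NP: "N * P \<in> carrier_mat r r" using P M N by auto
  have D: "P * M - N * P \<in> carrier_mat r r" by (rule minus_carrier_mat[OF NP])
  have "M = Q * (P * M)" using QP M by (simp add: assoc_mult_mat[OF Q P M, symmetric])
  then have "vec_space.rank r M \<le> vec_space.rank r (P * M)" using rank_mult_left_le[OF Q PM] by simp
  also have "P * M = N * P + (P * M - N * P)" by (rule eq_matI) (use P M N in auto)
  also have "vec_space.rank r \<dots> \<le> vec_space.rank r (N * P) + vec_space.rank r (P * M - N * P)"
    by (rule vec_space.rank_subadditive[OF NP D])
  also have "vec_space.rank r (N * P) \<le> vec_space.rank r N" by (rule rank_mult_right_le[OF N P])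
  finally show ?thesis by simp
qed

text \<open>Scalar matrices commute with \<open>P\<close>, so a common shift of \<open>M\<close> and
  \<open>N\<close> cancels in the defect.\<close>

lemma intertwining_shift:
  fixes P M N :: "'a::comm_ring_1 mat"
  assumes "P \<in> carrier_mat r r" and "M \<in> carrier_mat r r" and "N \<in> carrier_mat r r"
  shows "P * (M - b \<cdot>\<^sub>m 1\<^sub>m r) - (N - b \<cdot>\<^sub>m 1\<^sub>m r) * P = P * M - N * P"
proof -
  have PM: "P * M \<in> carrier_mat r r" and NP: "N * P \<in> carrier_mat r r" using assms by auto
  have "P * (M - b \<cdot>\<^sub>m 1\<^sub>m r) = P * M - b \<cdot>\<^sub>m P"
    using assms by (simp add: mult_minus_distrib_mat[of P r r M r] mult_smult_distrib[of P r r _ r])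
  moreover have "(N - b \<cdot>\<^sub>m 1\<^sub>m r) * P = N * P - b \<cdot>\<^sub>m P"
    using assms by (simp add: minus_mult_distrib_mat[of N r r _ P r] mult_smult_assoc_mat[of _ r r P r])
  ultimately show ?thesis by (intro eq_matI) (use assms PM NP in auto)
qed

text \<open>Exact intertwining passes to powers. The constant term of a quadratic polynomial is
  supplied separately by \<open>intertwining_shift\<close>.\<close>

lemma intertwining_quadratic:
  fixes P M N :: "'a::comm_ring_1 mat"
  assumes P: "P \<in> carrier_mat r r" and M: "M \<in> carrier_mat r r" and N: "N \<in> carrier_mat r r"
    and PM: "P * M = N * P"
  shows "P * (M * M - s \<cdot>\<^sub>m M) = (N * N - s \<cdot>\<^sub>m N) * P"
proof -
  have "P * (M * M) = N * N * P"
    using PM by (metis P M N assoc_mult_mat)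
  then show ?thesis
    using assms by (simp add: mult_minus_distrib_mat[of P r r _ r] mult_smult_distrib[of P r r]
      minus_mult_distrib_mat[of _ r r _ P r] mult_smult_assoc_mat[of _ r r P r])
qed

section \<open>Two-by-two matrices: Cayley-Hamilton, inverse and cyclic vector\<close>

lemma eq_mat_2I:
  assumes "A \<in> carrier_mat 2 2" and "B \<in> carrier_mat 2 2"
    and "A $$ (0,0) = B $$ (0,0)" "A $$ (0,1) = B $$ (0,1)" "A $$ (1,0) = B $$ (1,0)" "A $$ (1,1) = B $$ (1,1)"
  shows "A = B"
  by (rule eq_matI) (use assms in \<open>auto simp: less_2_cases_iff\<close>)

lemma index_mult_mat_2:
  assumes "A \<in> carrier_mat 2 2" and "B \<in> carrier_mat 2 2" and "i < 2" and "j < 2"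
  shows "(A * B) $$ (i,j) = A $$ (i,0) * B $$ (0,j) + A $$ (i,1) * B $$ (1,j)"
  using assms by (simp add: scalar_prod_def sum.atLeast0_lessThan_Suc numeral_2_eq_2)

text \<open>Trace on the left, minus the determinant on the right: the constant term stays apart, as
  a scalar shift.\<close>

lemma cayley_hamilton_2:
  fixes B :: "'a::comm_ring_1 mat"
  assumes "B \<in> carrier_mat 2 2"
  shows "B * B - (B $$ (0,0) + B $$ (1,1)) \<cdot>\<^sub>m B
    = (B $$ (0,1) * B $$ (1,0) - B $$ (0,0) * B $$ (1,1)) \<cdot>\<^sub>m 1\<^sub>m 2"
proof (rule eq_mat_2I)
  show "B * B - (B $$ (0,0) + B $$ (1,1)) \<cdot>\<^sub>m B \<in> carrier_mat 2 2"
    using assms by (simp add: minus_carrier_mat)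
qed (use assms in \<open>simp_all del: index_mult_mat(1) add: index_mult_mat_2 algebra_simps\<close>)

lemma inverse_mat_2:
  fixes Q :: "'a::field mat"
  assumes "Q \<in> carrier_mat 2 2" and "Q $$ (0,0) * Q $$ (1,1) \<noteq> Q $$ (0,1) * Q $$ (1,0)"
  obtains G where "G \<in> carrier_mat 2 2" "Q * G = 1\<^sub>m 2" "G * Q = 1\<^sub>m 2"
proof -
  let ?d = "Q $$ (0,0) * Q $$ (1,1) - Q $$ (0,1) * Q $$ (1,0)"
  \<comment> \<open>The adjugate divided by the determinant; \<open>1-i\<close> exchanges the
    indices 0 and 1.\<close>
  define G where "G = mat 2 2 (\<lambda>(i,j). (if i = j then Q $$ (1-i,1-j) else - Q $$ (i,j)) / ?d)"
  have Gm: "G \<in> carrier_mat 2 2" by (simp add: G_def)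
  have d: "?d \<noteq> 0" using assms(2) by simp
  have "Q * G = 1\<^sub>m 2"
    by (rule eq_mat_2I; use assms(1) d in \<open>simp del: index_mult_mat(1) add: index_mult_mat_2 Gm\<close>;
      simp add: G_def divide_simps; simp add: algebra_simps)
  moreover from this have "G * Q = 1\<^sub>m 2" by (rule mat_mult_left_right_inverse[OF assms(1) Gm])
  ultimately show thesis using that[OF Gm] by simp
qed

text \<open>If \<open>e\<close> and \<open>B *\<^sub>v e\<close> were dependent for every
  \<open>e\<close>, every vector would be an eigenvector or zero, and \<open>B\<close> would be
  scalar.\<close>

lemma cyclic_vector_2:
  fixes B :: "'a::field mat"
  assumes B: "B \<in> carrier_mat 2 2" and ns: "\<And>b. B \<noteq> b \<cdot>\<^sub>m 1\<^sub>m 2"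
  obtains e G where "e \<in> carrier_vec 2" "G \<in> carrier_mat 2 2"
    "mat_of_cols 2 [e, B *\<^sub>v e] * G = 1\<^sub>m 2" "G * mat_of_cols 2 [e, B *\<^sub>v e] = 1\<^sub>m 2"
proof -
  \<comment> \<open>The two sides differ exactly when the determinant of [e, B e] is
    nonzero.\<close>
  have "\<exists>e\<in>carrier_vec 2. e $ 0 * (B *\<^sub>v e) $ 1 \<noteq> (B *\<^sub>v e) $ 0 * e $ 1"
  proof (rule ccontr)
    assume "\<not> ?thesis"
    then have *: "e $ 0 * (B *\<^sub>v e) $ 1 = (B *\<^sub>v e) $ 0 * e $ 1" if "e \<in> carrier_vec 2" for e using that by blast
    have **: "x * (B $$ (1,0) * x + B $$ (1,1) * y) = (B $$ (0,0) * x + B $$ (0,1) * y) * y" for x y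
      using *[of "vec 2 (\<lambda>i. if i = 0 then x else y)"] B by (simp add: scalar_prod_def numeral_2_eq_2)
    \<comment> \<open>The unit vectors kill the off-diagonal entries; the vector (1, 1) then equates
      the diagonal ones.\<close>
    have "B $$ (1,0) = 0" "B $$ (0,1) = 0" using **[of 1 0] **[of 0 1] by auto
    moreover from this have "B $$ (0,0) = B $$ (1,1)" using **[of 1 1] by auto
    ultimately have "B = B $$ (0,0) \<cdot>\<^sub>m 1\<^sub>m 2"
      by (intro eq_matI) (use B in \<open>auto simp: less_2_cases_iff\<close>)
    with ns show False by blast
  qed
  then obtain e where e: "e \<in> carrier_vec 2" "e $ 0 * (B *\<^sub>v e) $ 1 \<noteq> (B *\<^sub>v e) $ 0 * e $ 1" by blast
  let ?Q = "mat_of_cols 2 [e, B *\<^sub>v e]"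
  have "?Q \<in> carrier_mat 2 2" using mat_of_cols_carrier(1)[of 2 "[e, B *\<^sub>v e]"] by (simp add: numeral_2_eq_2)
  moreover have "?Q $$ (0,0) * ?Q $$ (1,1) \<noteq> ?Q $$ (0,1) * ?Q $$ (1,0)"
    using e(2) by (simp add: mat_of_cols_index)
  ultimately show thesis using inverse_mat_2 that e(1) by metis
qed

section \<open>Shifts and quadratic polynomials of block triangular matrices\<close>

lemma mult_four_block_upper:
  fixes A :: "'a::ring_1 mat"
  assumes "A \<in> carrier_mat m m" "B \<in> carrier_mat n n" "C \<in> carrier_mat m n"
  shows "four_block_mat A C (0\<^sub>m n m) B * four_block_mat A C (0\<^sub>m n m) B
    = four_block_mat (A * A) (A * C + C * B) (0\<^sub>m n m) (B * B)"
  by (subst mult_four_block_mat[of _ m m _ n _ n _ _ m _ n]) (use assms in auto)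

lemma shift_four_block_upper:
  fixes A :: "'a::comm_ring_1 mat"
  assumes "A \<in> carrier_mat m m" "B \<in> carrier_mat n n" "C \<in> carrier_mat m n"
  shows "four_block_mat A C (0\<^sub>m n m) B - b \<cdot>\<^sub>m 1\<^sub>m (m + n)
    = four_block_mat (A - b \<cdot>\<^sub>m 1\<^sub>m m) C (0\<^sub>m n m) (B - b \<cdot>\<^sub>m 1\<^sub>m n)"
  by (rule eq_matI) (use assms in auto)

text \<open>With q(t) = t^2 - s t - p, the hypothesis says q(B) = 0, so evaluating q at the block
  matrix leaves only its first block row.\<close>

lemma quadratic_four_block_upper:
  fixes A :: "'a::comm_ring_1 mat"
  assumes A: "A \<in> carrier_mat m m" and B: "B \<in> carrier_mat n n" and C: "C \<in> carrier_mat m n"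
    and q: "B * B - s \<cdot>\<^sub>m B = p \<cdot>\<^sub>m 1\<^sub>m n"
  shows "four_block_mat A C (0\<^sub>m n m) B * four_block_mat A C (0\<^sub>m n m) B - s \<cdot>\<^sub>m four_block_mat A C (0\<^sub>m n m) B
      - p \<cdot>\<^sub>m 1\<^sub>m (m + n)
    = four_block_mat (A * A - s \<cdot>\<^sub>m A - p \<cdot>\<^sub>m 1\<^sub>m m) (A * C + C * B - s \<cdot>\<^sub>m C) (0\<^sub>m n m) (0\<^sub>m n n)"
proof -
  have "four_block_mat A C (0\<^sub>m n m) B * four_block_mat A C (0\<^sub>m n m) B - s \<cdot>\<^sub>m four_block_mat A C (0\<^sub>m n m) B
    = four_block_mat (A * A - s \<cdot>\<^sub>m A) (A * C + C * B - s \<cdot>\<^sub>m C) (0\<^sub>m n m) (p \<cdot>\<^sub>m 1\<^sub>m n)"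
    unfolding mult_four_block_upper[OF A B C] q[symmetric]
    by (rule eq_matI) (use A B C in auto)
  moreover have "A * A - s \<cdot>\<^sub>m A \<in> carrier_mat m m" "A * C + C * B - s \<cdot>\<^sub>m C \<in> carrier_mat m n"
    using A C by (auto intro!: minus_carrier_mat)
  ultimately show ?thesis
    using shift_four_block_upper[of "A * A - s \<cdot>\<^sub>m A" m "p \<cdot>\<^sub>m 1\<^sub>m n" n "A * C + C * B - s \<cdot>\<^sub>m C" p]
      minus_r_inv_mat[of "p \<cdot>\<^sub>m 1\<^sub>m n" n n] by simp
qed

section \<open>Matrices with two columns, studied in the basis \<open>e\<close>,
  \<open>B *\<^sub>v e\<close>\<close>

context
  fixes B :: "'a::field mat" and e :: "'a vec" and G :: "'a mat"
  assumes B: "B \<in> carrier_mat 2 2" and e: "e \<in> carrier_vec 2" and G: "G \<in> carrier_mat 2 2"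
    and QG: "mat_of_cols 2 [e, B *\<^sub>v e] * G = 1\<^sub>m 2" and GQ: "G * mat_of_cols 2 [e, B *\<^sub>v e] = 1\<^sub>m 2"
begin

lemma cyclic_mat_carrier: "mat_of_cols 2 [e, B *\<^sub>v e] \<in> carrier_mat 2 2"
  using mat_of_cols_carrier(1)[of 2 "[e, B *\<^sub>v e]"] by (simp add: numeral_2_eq_2)

lemma col_mult_cyclic_mat:
  assumes "R \<in> carrier_mat m 2"
  shows "col (R * mat_of_cols 2 [e, B *\<^sub>v e]) 0 = R *\<^sub>v e"
    and "col (R * mat_of_cols 2 [e, B *\<^sub>v e]) 1 = R *\<^sub>v (B *\<^sub>v e)"
proof -
  have Be: "B *\<^sub>v e \<in> carrier_vec 2" using B e by simp
  show "col (R * mat_of_cols 2 [e, B *\<^sub>v e]) 0 = R *\<^sub>v e"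
    using e by (subst col_mult2[OF assms cyclic_mat_carrier]) auto
  show "col (R * mat_of_cols 2 [e, B *\<^sub>v e]) 1 = R *\<^sub>v (B *\<^sub>v e)"
    using Be by (subst col_mult2[OF assms cyclic_mat_carrier]) auto
qed

text \<open>\<open>G\<close> inverts the basis matrix, so \<open>X\<close> is the matrix with
  columns \<open>y1\<close>, \<open>y2\<close> times \<open>G\<close>.\<close>

lemma cyclic_interpolation:
  assumes "y1 \<in> carrier_vec m" and "y2 \<in> carrier_vec m"
  obtains X where "X \<in> carrier_mat m 2" "X *\<^sub>v e = y1" "X *\<^sub>v (B *\<^sub>v e) = y2"
proof -
  let ?Y = "mat_of_cols m [y1, y2]"
  have Y: "?Y \<in> carrier_mat m 2" using mat_of_cols_carrier(1)[of m "[y1, y2]"] by (simp add: numeral_2_eq_2)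
  have X: "?Y * G \<in> carrier_mat m 2" using Y G by simp
  have "?Y * G * mat_of_cols 2 [e, B *\<^sub>v e] = ?Y"
    using assoc_mult_mat[OF Y G cyclic_mat_carrier] Y GQ by simp
  then show thesis using that[OF X] col_mult_cyclic_mat[OF X] assms by simp
qed

lemma mult_cyclic_cancel:
  assumes "R \<in> carrier_mat m 2"
  shows "R * mat_of_cols 2 [e, B *\<^sub>v e] * G = R"
  using assoc_mult_mat[OF assms cyclic_mat_carrier G] assms QG by simp

text \<open>In the cyclic basis the first column of \<open>R\<close> vanishes; the change of basis
  by \<open>G\<close> does not raise the rank.\<close>

lemma rank_le_1_if_kills_cyclic:
  assumes R: "R \<in> carrier_mat m 2" and Re: "R *\<^sub>v e = 0\<^sub>v m"
  shows "vec_space.rank m R \<le> 1"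
proof -
  let ?S = "R * mat_of_cols 2 [e, B *\<^sub>v e]"
  have S: "?S \<in> carrier_mat m 2" using R cyclic_mat_carrier by simp
  have "?S $$ (r,0) = 0" if "r < m" for r
  proof -
    have "?S $$ (r,0) = col ?S 0 $ r" using that S by (subst index_col) auto
    then show ?thesis using col_mult_cyclic_mat(1)[OF R] Re that by simp
  qed
  then have "vec_space.rank m ?S \<le> 1"
    \<comment> \<open>\<open>?S\<close> is the outer product of its second column with the row (0,
      1).\<close>
    using S by (intro vec_space.rank_le_1_product_entries[OF S, of "\<lambda>r. ?S $$ (r,1)" "\<lambda>c. if c = 1 then 1 else 0"])
      (auto simp del: index_mult_mat simp: less_2_cases_iff)
  then show ?thesis using rank_mult_right_le[OF S G] mult_cyclic_cancel[OF R] by simp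
qed

lemma zero_if_kills_cyclic:
  assumes R: "R \<in> carrier_mat m 2" and "R *\<^sub>v e = 0\<^sub>v m" and "R *\<^sub>v (B *\<^sub>v e) = 0\<^sub>v m"
  shows "R = 0\<^sub>m m 2"
proof -
  have "R * mat_of_cols 2 [e, B *\<^sub>v e] = 0\<^sub>m m 2"
    using R col_mult_cyclic_mat[OF R] assms(2,3) by (intro mat_col_eqI) (auto simp: less_2_cases_iff simp del: col_mult2)
  then show ?thesis using mult_cyclic_cancel[OF R] G by simp
qed

end

section \<open>The hard inequality when \<open>B\<close> has size at most two\<close>

lemma smult_mat_mult_vec:
  fixes A :: "'a::comm_ring_1 mat"
  assumes "A \<in> carrier_mat r c" and "v \<in> carrier_vec c"
  shows "(k \<cdot>\<^sub>m A) *\<^sub>v v = k \<cdot>\<^sub>v (A *\<^sub>v v)"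
  by (rule eq_vecI) (use assms in \<open>auto simp: scalar_prod_def sum_distrib_left mult.assoc\<close>)

lemma sylvester_mult_vec:
  fixes A :: "'a::comm_ring_1 mat"
  assumes A: "A \<in> carrier_mat m m" and B: "B \<in> carrier_mat n n" and C: "C \<in> carrier_mat m n"
    and X: "X \<in> carrier_mat m n" and v: "v \<in> carrier_vec n"
  shows "(A * X - X * B - C) *\<^sub>v v = A *\<^sub>v (X *\<^sub>v v) - X *\<^sub>v (B *\<^sub>v v) - C *\<^sub>v v"
proof -
  have AX: "A * X \<in> carrier_mat m n" and XB: "X * B \<in> carrier_mat m n" using A X B by auto
  have D: "A * X - X * B \<in> carrier_mat m n" by (rule minus_carrier_mat[OF XB])
  show ?thesis
    using minus_mult_distrib_mat_vec[OF D C v] minus_mult_distrib_mat_vec[OF AX XB v]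
      assoc_mult_mat_vec[OF A X v] assoc_mult_mat_vec[OF X B v] by simp
qed

text \<open>Three cases: \<open>B\<close> scalar; \<open>B\<close> not scalar with a nonzero defect,
  where a residual of rank one suffices; \<open>B\<close> not scalar with exact intertwining, where
  the equation has to be solved exactly.\<close>

lemma sylvester_rank_le_cols:
  fixes A B C P Q :: "'a::field mat" and m n :: nat
  defines "M \<equiv> four_block_mat A C (0\<^sub>m n m) B" and "N \<equiv> four_block_mat A (0\<^sub>m m n) (0\<^sub>m n m) B"
  assumes A: "A \<in> carrier_mat m m" and B: "B \<in> carrier_mat n n" and C: "C \<in> carrier_mat m n"
    and n: "0 < n" "n < 3"
    and P: "P \<in> carrier_mat (m + n) (m + n)" and Q: "Q \<in> carrier_mat (m + n) (m + n)"
    and QP: "Q * P = 1\<^sub>m (m + n)"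
  obtains X where "X \<in> carrier_mat m n"
    "vec_space.rank m (A * X - X * B - C) \<le> vec_space.rank (m + n) (P * M - N * P)"
proof -
  have M: "M \<in> carrier_mat (m + n) (m + n)" and N: "N \<in> carrier_mat (m + n) (m + n)"
    unfolding M_def N_def using A B by auto
  let ?k = "vec_space.rank (m + n) (P * M - N * P)"
  show thesis
  proof (cases "\<exists>b. B = b \<cdot>\<^sub>m 1\<^sub>m n")
    case True
    then obtain b where b: "B = b \<cdot>\<^sub>m 1\<^sub>m n" by blast
    let ?D = "A - b \<cdot>\<^sub>m 1\<^sub>m m"
    have D: "?D \<in> carrier_mat m m" by (simp add: minus_carrier_mat)
    have B0: "B - b \<cdot>\<^sub>m 1\<^sub>m n = 0\<^sub>m n n" unfolding b by (rule eq_matI) auto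
    have sh: "M - b \<cdot>\<^sub>m 1\<^sub>m (m + n) = four_block_mat ?D C (0\<^sub>m n m) (0\<^sub>m n n)"
      "N - b \<cdot>\<^sub>m 1\<^sub>m (m + n) = four_block_mat ?D (0\<^sub>m m n) (0\<^sub>m n m) (0\<^sub>m n n)"
      unfolding M_def N_def using shift_four_block_upper[OF A B] C B0 by auto
    have "vec_space.rank (m + n) (M - b \<cdot>\<^sub>m 1\<^sub>m (m + n)) \<le> vec_space.rank (m + n) (N - b \<cdot>\<^sub>m 1\<^sub>m (m + n)) + ?k"
      using rank_le_intertwining[OF P Q _ _ QP, of "M - b \<cdot>\<^sub>m 1\<^sub>m (m + n)" "N - b \<cdot>\<^sub>m 1\<^sub>m (m + n)"]
        intertwining_shift[OF P M N] by (simp add: minus_carrier_mat)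
    then obtain X where X: "X \<in> carrier_mat m n" "vec_space.rank m (?D * X - C) \<le> ?k"
      using rank_block_reduce[OF D C] sh by metis
    have "?D * X = A * X - X * B"
      unfolding b using A X(1) minus_mult_distrib_mat[OF A _ X(1), of "b \<cdot>\<^sub>m 1\<^sub>m m"]
        mult_smult_assoc_mat[of "1\<^sub>m m" m m X n b] mult_smult_distrib[OF X(1), of "1\<^sub>m n" n b] by simp
    then show thesis using that X by simp
  next
    case False
    \<comment> \<open>A matrix of size one is scalar, so size two is the only possibility
      left.\<close>
    have n2: "n = 2"
    proof (rule ccontr)
      assume "n \<noteq> 2"
      then have "n = 1" using n by simp
      then have "B = B $$ (0,0) \<cdot>\<^sub>m 1\<^sub>m n" by (intro eq_matI) (use B in auto)
      with False show False by blast
    qed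
    note B2 = B[unfolded n2] and C2 = C[unfolded n2]
    obtain e G where e: "e \<in> carrier_vec 2" and G: "G \<in> carrier_mat 2 2"
      and QG: "mat_of_cols 2 [e, B *\<^sub>v e] * G = 1\<^sub>m 2" "G * mat_of_cols 2 [e, B *\<^sub>v e] = 1\<^sub>m 2"
      using cyclic_vector_2[OF B2] False n2 by metis
    note cyc = B2 e G QG
    have Be: "B *\<^sub>v e \<in> carrier_vec 2" using B2 e by simp
    have Rm: "A * X - X * B - C \<in> carrier_mat m 2" for X by (rule minus_carrier_mat[OF C2])
    show thesis
    proof (cases "?k = 0")
      case False
      \<comment> \<open>These values make the residual at \<open>e\<close> equal to A 0 + C e - C e
        = 0.\<close>
      obtain X where X: "X \<in> carrier_mat m 2" "X *\<^sub>v e = 0\<^sub>v m" "X *\<^sub>v (B *\<^sub>v e) = - (C *\<^sub>v e)"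
        using cyclic_interpolation[OF cyc, of "0\<^sub>v m" m "- (C *\<^sub>v e)"] C2 e by auto
      have "(A * X - X * B - C) *\<^sub>v e = 0\<^sub>v m"
        unfolding sylvester_mult_vec[OF A B2 C2 X(1) e] X(2,3)
        by (rule eq_vecI) (use A C2 e in auto)
      then have "vec_space.rank m (A * X - X * B - C) \<le> 1"
        by (rule rank_le_1_if_kills_cyclic[OF cyc Rm])
      then show thesis using that[of X] X(1) n2 False by simp
    next
      case True
      have Dm: "P * M - N * P \<in> carrier_mat (m + n) (m + n)"
        using N P by (simp add: minus_carrier_mat)
      have PM: "P * M = N * P"
      proof -
        have "P * M - N * P = 0\<^sub>m (m + n) (m + n)"
          using vec_space.rank_zeroD[OF Dm True] .
        moreover have "P * M = (P * M - N * P) + N * P" by (rule eq_matI) (use P M N in auto)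
        ultimately show ?thesis using P N by simp
      qed
      \<comment> \<open>\<open>s\<close> is the trace and \<open>p\<close> minus the determinant, so
        q(t) = t^2 - s t - p is the characteristic polynomial of \<open>B\<close>. Below,
        \<open>?D\<close> is q(A) and \<open>?S\<close> the corner block of q(M).\<close>
      define s where "s = B $$ (0,0) + B $$ (1,1)"
      define p where "p = B $$ (0,1) * B $$ (1,0) - B $$ (0,0) * B $$ (1,1)"
      have CH: "B * B - s \<cdot>\<^sub>m B = p \<cdot>\<^sub>m 1\<^sub>m n"
        using cayley_hamilton_2[OF B2] unfolding s_def p_def n2 .
      let ?D = "A * A - s \<cdot>\<^sub>m A - p \<cdot>\<^sub>m 1\<^sub>m m" and ?S = "A * C + C * B - s \<cdot>\<^sub>m C"
      have D: "?D \<in> carrier_mat m m" by (simp add: minus_carrier_mat)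
      have S: "?S \<in> carrier_mat m n" using C by (simp add: minus_carrier_mat)
      let ?M = "M * M - s \<cdot>\<^sub>m M" and ?N = "N * N - s \<cdot>\<^sub>m N"
      have Mm: "?M \<in> carrier_mat (m + n) (m + n)" "?N \<in> carrier_mat (m + n) (m + n)"
        using M N by (simp_all add: minus_carrier_mat)
      have z: "?N * P - ?N * P = 0\<^sub>m (m + n) (m + n)" by (rule eq_matI) (use Mm P in auto)
      have rank0: "vec_space.rank (m + n) (0\<^sub>m (m + n) (m + n) :: 'a mat) = 0" by (rule vec_space.rank_0I)
      have "vec_space.rank (m + n) (?M - p \<cdot>\<^sub>m 1\<^sub>m (m + n)) \<le> vec_space.rank (m + n) (?N - p \<cdot>\<^sub>m 1\<^sub>m (m + n)) + 0"
        using rank_le_intertwining[OF P Q _ _ QP, of "?M - p \<cdot>\<^sub>m 1\<^sub>m (m + n)" "?N - p \<cdot>\<^sub>m 1\<^sub>m (m + n)"]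
        by (simp add: minus_carrier_mat intertwining_shift[OF P Mm] intertwining_quadratic[OF P M N PM] z rank0)
      \<comment> \<open>\<open>N\<close> is the case of zero corner block, so q(N) has zero corner
        as well and \<open>rank_block_reduce\<close> applies with \<open>k = 0\<close>.\<close>
      moreover have "A * 0\<^sub>m m n + 0\<^sub>m m n * B - s \<cdot>\<^sub>m 0\<^sub>m m n = 0\<^sub>m m n" by (rule eq_matI) (use A B in auto)
      ultimately obtain Z where Z: "Z \<in> carrier_mat m n" "vec_space.rank m (?D * Z - ?S) \<le> 0"
        using rank_block_reduce[OF D S, of 0] quadratic_four_block_upper[OF A B C CH]
          quadratic_four_block_upper[OF A B zero_carrier_mat CH] unfolding M_def N_def by metis
      have DS: "?D * Z - ?S = 0\<^sub>m m n"
        using vec_space.rank_zeroD[OF minus_carrier_mat[OF S]] Z(2) by simp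
      have Zm: "Z \<in> carrier_mat m 2" using Z(1) n2 by simp
      define x where "x = Z *\<^sub>v e"
      have x: "x \<in> carrier_vec m" using Zm e by (simp add: x_def)
      \<comment> \<open>Once X e = x is fixed, this is the only value of X B e for which the
        residual vanishes at \<open>e\<close>.\<close>
      define y where "y = A *\<^sub>v x - C *\<^sub>v e"
      have Ce: "C *\<^sub>v e \<in> carrier_vec m" and Ax: "A *\<^sub>v x \<in> carrier_vec m" and CBe: "C *\<^sub>v (B *\<^sub>v e) \<in> carrier_vec m"
        using C2 e A x Be by auto
      have y: "y \<in> carrier_vec m" unfolding y_def using Ce Ax by simp
      obtain X where X: "X \<in> carrier_mat m 2" "X *\<^sub>v e = x" "X *\<^sub>v (B *\<^sub>v e) = y"
        using cyclic_interpolation[OF cyc x y] .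
      have 1: "(A * X - X * B - C) *\<^sub>v e = 0\<^sub>v m"
        unfolding sylvester_mult_vec[OF A B2 C2 X(1) e] X(2,3) y_def
        by (rule eq_vecI) (use A C2 Ce Ax in auto)
      \<comment> \<open>Cayley-Hamilton brings B B e back to the basis, so that X B B e = s y + p x
        is known.\<close>
      have BB: "B *\<^sub>v (B *\<^sub>v e) = s \<cdot>\<^sub>v (B *\<^sub>v e) + p \<cdot>\<^sub>v e"
      proof -
        have "(B * B - s \<cdot>\<^sub>m B) *\<^sub>v e = B *\<^sub>v (B *\<^sub>v e) - s \<cdot>\<^sub>v (B *\<^sub>v e)"
          using minus_mult_distrib_mat_vec[of "B * B" 2 2 "s \<cdot>\<^sub>m B" e] B2 e by (simp add: smult_mat_mult_vec[of _ 2 2])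
        moreover have "(p \<cdot>\<^sub>m 1\<^sub>m n) *\<^sub>v e = p \<cdot>\<^sub>v e" using e n2 by (simp add: smult_mat_mult_vec[of _ 2 2])
        ultimately have *: "B *\<^sub>v (B *\<^sub>v e) - s \<cdot>\<^sub>v (B *\<^sub>v e) = p \<cdot>\<^sub>v e" using CH by simp
        show ?thesis unfolding *[symmetric] by (rule eq_vecI) (use B2 in auto)
      qed
      \<comment> \<open>The residual at B e is A y - (s y + p x) - C B e. Inserting y = A x - C e
        turns it into q(A) x - S e = (q(A) Z - S) e, which is zero by the choice of
        \<open>Z\<close>.\<close>
      have 2: "(A * X - X * B - C) *\<^sub>v (B *\<^sub>v e) = 0\<^sub>v m"
      proof -
        have AA: "A *\<^sub>v (A *\<^sub>v x) \<in> carrier_vec m" "A *\<^sub>v (C *\<^sub>v e) \<in> carrier_vec m" using A Ax Ce by auto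
        have "X *\<^sub>v (B *\<^sub>v (B *\<^sub>v e)) = s \<cdot>\<^sub>v y + p \<cdot>\<^sub>v x"
          unfolding BB using X Be e by (simp add: mult_add_distrib_mat_vec[OF X(1)] mult_mat_vec)
        moreover have "A *\<^sub>v y = A *\<^sub>v (A *\<^sub>v x) - A *\<^sub>v (C *\<^sub>v e)"
          unfolding y_def using mult_minus_distrib_mat_vec[OF A Ax Ce] .
        moreover have DZ: "?D *\<^sub>v x = A *\<^sub>v (A *\<^sub>v x) - s \<cdot>\<^sub>v (A *\<^sub>v x) - p \<cdot>\<^sub>v x"
          using A x by (simp add: minus_mult_distrib_mat_vec[of _ m m] smult_mat_mult_vec[of _ m m] minus_carrier_mat)
        moreover have "?S *\<^sub>v e = A *\<^sub>v (C *\<^sub>v e) + C *\<^sub>v (B *\<^sub>v e) - s \<cdot>\<^sub>v (C *\<^sub>v e)"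
          using A B2 C2 e by (simp add: minus_mult_distrib_mat_vec[of _ m 2] add_mult_distrib_mat_vec[of _ m 2]
            smult_mat_mult_vec[of _ m 2])
        moreover have "?D *\<^sub>v x - ?S *\<^sub>v e = 0\<^sub>v m"
        proof -
          have "(?D * Z - ?S) *\<^sub>v e = 0\<^sub>v m" unfolding DS by (rule eq_vecI) (use e n2 in \<open>auto simp: scalar_prod_def\<close>)
          then show ?thesis
            using minus_mult_distrib_mat_vec[of "?D * Z" m 2 ?S e] D S Zm e n2 by (simp add: x_def)
        qed
        ultimately have *: "(A *\<^sub>v (A *\<^sub>v x) - s \<cdot>\<^sub>v (A *\<^sub>v x) - p \<cdot>\<^sub>v x)
            - (A *\<^sub>v (C *\<^sub>v e) + C *\<^sub>v (B *\<^sub>v e) - s \<cdot>\<^sub>v (C *\<^sub>v e)) = 0\<^sub>v m"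
          and **: "(A * X - X * B - C) *\<^sub>v (B *\<^sub>v e)
            = A *\<^sub>v (A *\<^sub>v x) - A *\<^sub>v (C *\<^sub>v e) - (s \<cdot>\<^sub>v (A *\<^sub>v x - C *\<^sub>v e) + p \<cdot>\<^sub>v x) - C *\<^sub>v (B *\<^sub>v e)"
          unfolding sylvester_mult_vec[OF A B2 C2 X(1) Be] X(3) by (simp_all add: y_def)
        show ?thesis unfolding ** *[symmetric]
          by (rule eq_vecI) (use A C2 AA Ax Ce CBe x in \<open>auto simp: algebra_simps simp del: index_mult_mat_vec\<close>)
      qed
      have "A * X - X * B - C = 0\<^sub>m m 2"
        by (rule zero_if_kills_cyclic[OF cyc Rm 1 2])
      then have "vec_space.rank m (A * X - X * B - C) = 0" by (simp add: vec_space.rank_0I)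
      then show thesis using that[of X] X(1) n2 by simp
    qed
  qed
qed

section \<open>Transposition: the hard inequality when \<open>A\<close> has size at most two\<close>

text \<open>Multiplying the defect by \<open>Q\<close> on both sides gives
  \<open>M * Q - Q * N\<close>, whose transpose is the defect of the transposed pair with
  \<open>Q\<^sup>T\<close> in the role of \<open>P\<close>.\<close>

lemma transpose_intertwining:
  fixes M N P Q :: "'a::field mat"
  assumes P: "P \<in> carrier_mat r r" and Q: "Q \<in> carrier_mat r r" and M: "M \<in> carrier_mat r r" and N: "N \<in> carrier_mat r r"
    and PQ: "P * Q = 1\<^sub>m r" and QP: "Q * P = 1\<^sub>m r"
  shows "vec_space.rank r (Q\<^sup>T * M\<^sup>T - N\<^sup>T * Q\<^sup>T) \<le> vec_space.rank r (P * M - N * P)"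
proof -
  have PM: "P * M \<in> carrier_mat r r" and NP: "N * P \<in> carrier_mat r r" and MQ: "M * Q \<in> carrier_mat r r" and QN: "Q * N \<in> carrier_mat r r"
    using P Q M N by auto
  have D: "P * M - N * P \<in> carrier_mat r r" by (rule minus_carrier_mat[OF NP])
  have "Q * (P * M) = M" "N * P * Q = N"
    using assoc_mult_mat[OF Q P M] QP M assoc_mult_mat[OF N P Q] PQ N by auto
  then have "Q * (P * M - N * P) * Q = M * Q - Q * N"
    using Q P M N PM NP by (simp add: mult_minus_distrib_mat[OF Q PM NP] minus_mult_distrib_mat[OF M _ Q]
      assoc_mult_mat[OF Q NP Q])
  then have "Q\<^sup>T * M\<^sup>T - N\<^sup>T * Q\<^sup>T = (Q * (P * M - N * P) * Q)\<^sup>T"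
    using transpose_minus[OF MQ QN] transpose_mult[OF M Q] transpose_mult[OF Q N] by simp
  then have "vec_space.rank r (Q\<^sup>T * M\<^sup>T - N\<^sup>T * Q\<^sup>T) \<le> vec_space.rank r (Q * (P * M - N * P) * Q)"
    using rank_transpose_le[OF mult_carrier_mat[OF mult_carrier_mat[OF Q D] Q]] by simp
  also have "\<dots> \<le> vec_space.rank r (P * M - N * P)"
    using rank_mult_right_le[OF mult_carrier_mat[OF Q D] Q] rank_mult_left_le[OF Q D] by simp
  finally show ?thesis .
qed

text \<open>Transposing and exchanging the two diagonal blocks turns the pair
  \<open>(four_block_mat A C 0 B, four_block_mat A 0 0 B)\<close> into the pair of the same shape
  for \<open>(B\<^sup>T, A\<^sup>T, C\<^sup>T)\<close>.\<close>

lemma sylvester_rank_le_rows: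
  fixes A B C P Q :: "'a::field mat" and m n :: nat
  defines "M \<equiv> four_block_mat A C (0\<^sub>m n m) B" and "N \<equiv> four_block_mat A (0\<^sub>m m n) (0\<^sub>m n m) B"
  assumes A: "A \<in> carrier_mat m m" and B: "B \<in> carrier_mat n n" and C: "C \<in> carrier_mat m n"
    and m: "0 < m" "m < 3"
    and P: "P \<in> carrier_mat (m + n) (m + n)" and Q: "Q \<in> carrier_mat (m + n) (m + n)"
    and PQ: "P * Q = 1\<^sub>m (m + n)" and QP: "Q * P = 1\<^sub>m (m + n)"
  obtains X where "X \<in> carrier_mat m n"
    "vec_space.rank m (A * X - X * B - C) \<le> vec_space.rank (m + n) (P * M - N * P)"
proof -
  have M: "M \<in> carrier_mat (m + n) (m + n)" and N: "N \<in> carrier_mat (m + n) (m + n)"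
    unfolding M_def N_def using A B by auto
  \<comment> \<open>\<open>?J\<close> and \<open>?K\<close> are mutually inverse block swaps between
    the orders (m, n) and (n, m). Conjugation by them is multiplicative and does not raise
    rank.\<close>
  let ?J = "four_block_mat (0\<^sub>m n m) (1\<^sub>m n) (1\<^sub>m m) (0\<^sub>m m n) :: 'a mat"
  let ?K = "four_block_mat (0\<^sub>m m n) (1\<^sub>m m) (1\<^sub>m n) (0\<^sub>m n m) :: 'a mat"
  have J: "?J \<in> carrier_mat (n + m) (m + n)" and K: "?K \<in> carrier_mat (m + n) (n + m)"
    by (rule carrier_matI; simp)+
  have JK: "?J * ?K = 1\<^sub>m (n + m)"
    by (subst mult_four_block_mat[of _ n m _ n _ m _ _ n _ m]) auto
  have KJ: "?K * ?J = 1\<^sub>m (m + n)"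
    by (subst mult_four_block_mat[of _ m n _ m _ n _ _ m _ n]) auto
  have flip: "?J * (four_block_mat A Y (0\<^sub>m n m) B)\<^sup>T * ?K = four_block_mat B\<^sup>T Y\<^sup>T (0\<^sub>m m n) A\<^sup>T"
    if "Y \<in> carrier_mat m n" for Y
  proof -
    have "?J * (four_block_mat A Y (0\<^sub>m n m) B)\<^sup>T = four_block_mat Y\<^sup>T B\<^sup>T A\<^sup>T (0\<^sub>m m n)"
      unfolding transpose_four_block_mat[OF A that zero_carrier_mat B]
      by (subst mult_four_block_mat[of _ n m _ n _ m _ _ m _ n]) (use A B that in auto)
    then show ?thesis
      by (simp, subst mult_four_block_mat[of _ n m _ n _ m _ _ n _ m]) (use A B that in auto)
  qed
  let ?conj = "\<lambda>R. ?J * R * ?K"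
  have conj_carrier: "?conj R \<in> carrier_mat (n + m) (n + m)" if "R \<in> carrier_mat (m + n) (m + n)" for R
    using J K that by auto
  have conj_mult: "?conj R * ?conj S = ?conj (R * S)"
    if R: "R \<in> carrier_mat (m + n) (m + n)" and S: "S \<in> carrier_mat (m + n) (m + n)" for R S
  proof -
    have JR: "?J * R \<in> carrier_mat (n + m) (m + n)" and JS: "?J * S \<in> carrier_mat (n + m) (m + n)"
      and SK: "S * ?K \<in> carrier_mat (m + n) (n + m)" using J K R S by auto
    have "?conj R * ?conj S = ?J * R * (?K * (?J * S * ?K))"
      by (rule assoc_mult_mat[OF JR K conj_carrier[OF S]])
    moreover have "?K * (?J * (S * ?K)) = S * ?K"
      using assoc_mult_mat[OF K J SK, symmetric] left_mult_one_mat[OF SK] unfolding KJ by simp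
    ultimately show ?thesis
      using assoc_mult_mat[OF J S K] assoc_mult_mat[OF JR S K] assoc_mult_mat[OF J R S] by simp
  qed
  have PT: "P\<^sup>T \<in> carrier_mat (m + n) (m + n)" and QT: "Q\<^sup>T \<in> carrier_mat (m + n) (m + n)"
    and MT: "M\<^sup>T \<in> carrier_mat (m + n) (m + n)" and NT: "N\<^sup>T \<in> carrier_mat (m + n) (m + n)"
    using P Q M N by auto
  \<comment> \<open>Transposition reverses products: the new intertwiner comes from
    \<open>Q\<^sup>T\<close> and its left inverse from \<open>P\<^sup>T\<close>.\<close>
  have inv: "?conj (P\<^sup>T) * ?conj (Q\<^sup>T) = 1\<^sub>m (n + m)"
    unfolding conj_mult[OF PT QT] transpose_mult[OF Q P, symmetric] QP using J JK by simp
  obtain Y where Y: "Y \<in> carrier_mat n m"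
    and rankY: "vec_space.rank n (B\<^sup>T * Y - Y * A\<^sup>T - C\<^sup>T)
      \<le> vec_space.rank (n + m) (?conj (Q\<^sup>T) * ?conj (M\<^sup>T) - ?conj (N\<^sup>T) * ?conj (Q\<^sup>T))"
    using sylvester_rank_le_cols[of "B\<^sup>T" n "A\<^sup>T" m "C\<^sup>T" "?conj (Q\<^sup>T)" "?conj (P\<^sup>T)"]
      A B C m conj_carrier[OF QT] conj_carrier[OF PT] inv flip[OF C] flip[OF zero_carrier_mat]
    unfolding M_def N_def by auto
  have QM: "Q\<^sup>T * M\<^sup>T \<in> carrier_mat (m + n) (m + n)" and NQ: "N\<^sup>T * Q\<^sup>T \<in> carrier_mat (m + n) (m + n)"
    using QT MT NT by auto
  have D: "Q\<^sup>T * M\<^sup>T - N\<^sup>T * Q\<^sup>T \<in> carrier_mat (m + n) (m + n)" by (rule minus_carrier_mat[OF NQ])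
  have "?conj (Q\<^sup>T) * ?conj (M\<^sup>T) - ?conj (N\<^sup>T) * ?conj (Q\<^sup>T) = ?conj (Q\<^sup>T * M\<^sup>T - N\<^sup>T * Q\<^sup>T)"
    unfolding conj_mult[OF QT MT] conj_mult[OF NT QT] mult_minus_distrib_mat[OF J QM NQ]
    by (rule minus_mult_distrib_mat[symmetric, OF mult_carrier_mat[OF J QM] mult_carrier_mat[OF J NQ] K])
  then have "vec_space.rank (n + m) (?conj (Q\<^sup>T) * ?conj (M\<^sup>T) - ?conj (N\<^sup>T) * ?conj (Q\<^sup>T))
      \<le> vec_space.rank (m + n) (Q\<^sup>T * M\<^sup>T - N\<^sup>T * Q\<^sup>T)"
    using rank_mult_right_le[OF mult_carrier_mat[OF J D] K] rank_mult_left_le[OF J D] by simp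
  with rankY transpose_intertwining[OF P Q M N PQ QP]
  have rankY': "vec_space.rank n (B\<^sup>T * Y - Y * A\<^sup>T - C\<^sup>T) \<le> vec_space.rank (m + n) (P * M - N * P)"
    by linarith
  have YT: "Y\<^sup>T \<in> carrier_mat m n" using Y by simp
  have BY: "B\<^sup>T * Y \<in> carrier_mat n m" and YA: "Y * A\<^sup>T \<in> carrier_mat n m" using A B Y by auto
  have YB: "Y\<^sup>T * B \<in> carrier_mat m n" and AY: "A * Y\<^sup>T \<in> carrier_mat m n" using A B YT by auto
  have "(B\<^sup>T * Y)\<^sup>T = Y\<^sup>T * B" "(Y * A\<^sup>T)\<^sup>T = A * Y\<^sup>T"
    using transpose_mult[of "B\<^sup>T" n n Y m] transpose_mult[of Y n m "A\<^sup>T" m] A B Y by auto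
  then have "(B\<^sup>T * Y - Y * A\<^sup>T - C\<^sup>T)\<^sup>T = Y\<^sup>T * B - A * Y\<^sup>T - C"
    using transpose_minus[OF minus_carrier_mat[OF YA], of "C\<^sup>T" "B\<^sup>T * Y"] transpose_minus[OF BY YA] C by simp
  \<comment> \<open>Transposing exchanges the two products of the Sylvester residual, hence the sign
    in the solution \<open>- Y\<^sup>T\<close>.\<close>
  also have "\<dots> = A * (- Y\<^sup>T) - (- Y\<^sup>T) * B - C"
    using uminus_mult_left_mat[of "Y\<^sup>T" B] uminus_mult_right_mat[of A "Y\<^sup>T"] A B YT
    by (intro eq_matI) (use C in auto)
  finally have "vec_space.rank m (A * (- Y\<^sup>T) - (- Y\<^sup>T) * B - C) \<le> vec_space.rank n (B\<^sup>T * Y - Y * A\<^sup>T - C\<^sup>T)"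
    using rank_transpose_le[of "B\<^sup>T * Y - Y * A\<^sup>T - C\<^sup>T" n m] C by (simp add: minus_carrier_mat)
  then show thesis using that[of "- Y\<^sup>T"] YT rankY' by simp
qed

section \<open>The easy inequality, and the comparison of the two minima\<close>

text \<open>For unipotent \<open>P\<close> the diagonal blocks of the defect cancel, and its corner
  block is C + X B - A X, the negative of the Sylvester residual.\<close>

lemma sylvester_rank_attained:
  fixes A B C X :: "'a::field mat"
  assumes A: "A \<in> carrier_mat m m" and B: "B \<in> carrier_mat n n" and C: "C \<in> carrier_mat m n" and X: "X \<in> carrier_mat m n"
  defines "P \<equiv> four_block_mat (1\<^sub>m m) X (0\<^sub>m n m) (1\<^sub>m n)"
  shows "vec_space.rank (m + n) (P * four_block_mat A C (0\<^sub>m n m) B - four_block_mat A (0\<^sub>m m n) (0\<^sub>m n m) B * P)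
    \<le> vec_space.rank m (A * X - X * B - C)"
proof -
  define R where "R = A * X - X * B - C"
  have R: "R \<in> carrier_mat m n" unfolding R_def by (rule minus_carrier_mat[OF C])
  \<comment> \<open>\<open>?L * R * ?U\<close> places \<open>- R\<close> in the upper right corner
    of a zero matrix.\<close>
  let ?L = "four_block_mat (- 1\<^sub>m m) (0\<^sub>m m 0) (0\<^sub>m n m) (0\<^sub>m n 0) :: 'a mat"
  let ?U = "four_block_mat (0\<^sub>m n m) (1\<^sub>m n) (0\<^sub>m 0 m) (0\<^sub>m 0 n) :: 'a mat"
  have L: "?L \<in> carrier_mat (m + n) m" and U: "?U \<in> carrier_mat n (m + n)"
    by (rule carrier_matI; simp)+
  have R': "four_block_mat R (0\<^sub>m m 0) (0\<^sub>m 0 n) (0\<^sub>m 0 0) = R"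
    by (rule eq_matI) (use R in auto)
  have PM: "P * four_block_mat A C (0\<^sub>m n m) B = four_block_mat A (C + X * B) (0\<^sub>m n m) B"
    unfolding P_def by (subst mult_four_block_mat[of _ m m _ n _ n _ _ m _ n]) (use A B C X in auto)
  have NP: "four_block_mat A (0\<^sub>m m n) (0\<^sub>m n m) B * P = four_block_mat A (A * X) (0\<^sub>m n m) B"
    unfolding P_def by (subst mult_four_block_mat[of _ m m _ n _ n _ _ m _ n]) (use A B C X in auto)
  have "?L * four_block_mat R (0\<^sub>m m 0) (0\<^sub>m 0 n) (0\<^sub>m 0 0) = four_block_mat (- R) (0\<^sub>m m 0) (0\<^sub>m n n) (0\<^sub>m n 0)"
    by (subst mult_four_block_mat[of _ m m _ 0 _ n _ _ n _ 0]) (use R in auto)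
  then have "?L * R * ?U = four_block_mat (0\<^sub>m m m) (- R) (0\<^sub>m n m) (0\<^sub>m n n)"
    unfolding R' by (simp, subst mult_four_block_mat[of _ m n _ 0 _ n _ _ m _ n]) (use R in auto)
  moreover have "P * four_block_mat A C (0\<^sub>m n m) B - four_block_mat A (0\<^sub>m m n) (0\<^sub>m n m) B * P
      = four_block_mat (0\<^sub>m m m) (- R) (0\<^sub>m n m) (0\<^sub>m n n)"
    unfolding PM NP R_def by (rule eq_matI) (use A B C X in auto)
  ultimately show ?thesis
    using rank_mult_right_le[OF mult_carrier_mat[OF L R] U] rank_mult_left_le[OF L R] by (simp add: R_def)
qed

lemma GL_inverseE:
  assumes "P \<in> GL r"
  obtains Q where "Q \<in> carrier_mat r r" "P * Q = 1\<^sub>m r" "Q * P = 1\<^sub>m r"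
proof -
  obtain Q where P: "P \<in> carrier_mat r r" and "inverts_mat P Q" "inverts_mat Q P"
    using assms unfolding GL_def invertible_mat_def by auto
  then have PQ: "P * Q = 1\<^sub>m r" and QP: "Q * P = 1\<^sub>m (dim_row Q)" unfolding inverts_mat_def by auto
  \<comment> \<open>\<open>inverts_mat\<close> leaves the size of \<open>Q\<close> open; comparing
    column counts in both products fixes it.\<close>
  have "dim_col Q = r" "dim_row Q = r"
    using arg_cong[OF PQ, of dim_col] arg_cong[OF QP, of dim_col] P by auto
  then show thesis using that[of Q] PQ QP by auto
qed

text \<open>Block unipotent matrices multiply by adding their corners, so negating \<open>X\<close>
  gives the inverse.\<close>

lemma unipotent_in_GL:
  assumes X: "X \<in> carrier_mat m n"
  shows "four_block_mat (1\<^sub>m m) X (0\<^sub>m n m) (1\<^sub>m n) \<in> GL (m + n)"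
proof -
  let ?P = "\<lambda>X :: complex mat. four_block_mat (1\<^sub>m m) X (0\<^sub>m n m) (1\<^sub>m n)"
  have mult: "?P X * ?P Y = ?P (X + Y)" if "X \<in> carrier_mat m n" "Y \<in> carrier_mat m n" for X Y
    by (subst mult_four_block_mat[of _ m m _ n _ n _ _ m _ n]) (use that in \<open>auto simp: comm_add_mat[of Y m n X]\<close>)
  have "X + - X = 0\<^sub>m m n" "- X + X = 0\<^sub>m m n" using X by (auto intro!: eq_matI)
  then have "?P X * ?P (- X) = 1\<^sub>m (m + n)" "?P (- X) * ?P X = 1\<^sub>m (m + n)"
    using mult[of X "- X"] mult[of "- X" X] X by simp_all
  then have "inverts_mat (?P X) (?P (- X))" "inverts_mat (?P (- X)) (?P X)"
    unfolding inverts_mat_def by simp_all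
  then show ?thesis unfolding GL_def invertible_mat_def by auto
qed

theorem proposition4p3:
  fixes m n :: nat and A B C :: "complex mat"
  assumes "m > 0" and "n > 0" and "min m n < 3"
    and "A \<in> carrier_mat m m" and "B \<in> carrier_mat n n" and "C \<in> carrier_mat m n"
  shows "(MIN X \<in> carrier_mat m n. rank_rows m (A * X - X * B - C)) =
    (MIN P \<in> GL (m + n). rank_rows (m + n)
       (P * four_block_mat A C (0\<^sub>m n m) B
        - four_block_mat A (0\<^sub>m m n) (0\<^sub>m n m) B * P))"
    (is "Min (?f ` ?S) = Min (?g ` ?G)")
proof (rule antisym)
  note ABC = assms(4-6)
  have fin_f: "finite (?f ` ?S)"
    by (rule finite_rank_image, rule minus_carrier_mat[OF ABC(3)])
  have fin_g: "finite (?g ` ?G)"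
    by (rule finite_rank_image[of _ _ "m + n" "m + n"], rule minus_carrier_mat)
      (use ABC in \<open>auto simp: GL_def intro!: mult_carrier_mat[of _ "m + n" "m + n"]\<close>)
  have ne_f: "?f ` ?S \<noteq> {}" using zero_carrier_mat by blast
  have ne_g: "?g ` ?G \<noteq> {}" using one_mat_in_GL by blast
  \<comment> \<open>Each inequality of minima follows once every value on the larger side is bounded
    below by some value on the other.\<close>
  have "\<exists>P\<in>?G. ?g P \<le> ?f X" if "X \<in> ?S" for X
    using sylvester_rank_attained[OF ABC that] unipotent_in_GL[OF that] by blast
  then show "Min (?g ` ?G) \<le> Min (?f ` ?S)"
    using fin_f ne_f fin_g by (subst Min_ge_iff) (auto intro: order_trans[OF Min_le])
  have "\<exists>X\<in>?S. ?f X \<le> ?g P" if P_GL: "P \<in> ?G" for P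
  proof -
    have P: "P \<in> carrier_mat (m + n) (m + n)" using P_GL by (simp add: GL_def)
    obtain Q where Q: "Q \<in> carrier_mat (m + n) (m + n)" "P * Q = 1\<^sub>m (m + n)" "Q * P = 1\<^sub>m (m + n)"
      using GL_inverseE[OF P_GL] .
    show ?thesis
    \<comment> \<open>The bound on \<open>min m n\<close> makes one of the two sizes at most two;
      the second case goes through transposition.\<close>
    proof (cases "n < 3")
      case True
      then show ?thesis using sylvester_rank_le_cols[OF ABC assms(2) _ P Q(1,3)] by blast
    next
      case False
      then have "m < 3" using assms(3) by simp
      then show ?thesis using sylvester_rank_le_rows[OF ABC assms(1) _ P Q] by blast
    qed
  qed
  then show "Min (?f ` ?S) \<le> Min (?g ` ?G)"
    using fin_g ne_g fin_f by (subst Min_ge_iff) (auto intro: order_trans[OF Min_le])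
qed

end
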